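(* Let $m,n\in\mathbb Z$ with $m<n$. Then the set $\mathcal N_{m,n}$ of normal Laurent polynomials in $\mathcal P_{m,n}$ is an open dense subset of $\mathcal P_{m,n}$.
   Context: $\mathbb T=\{z\in\mathbb C:|z|=1\}$. For integers $m\le n$, $\mathcal P_{m,n}$ is the set of Laurent polynomials $p(z)=\sum_{k=m}^n a_kz^k$ with complex coefficients such that $a_m\ne0$ and $a_n\ne0$; it carries the topology induced from the finite-dimensional vector space of coefficient vectors $(a_m,\dots,a_n)\in\mathbb C^{n-m+1}$. A $C^1$-smooth closed planar curve $\gamma$ is regular if its tangent vector $\gamma'$ never vanishes. A self-intersection of a closed curve is a pair of distinct parameter values (distinct points of the parameter circle) at which the curve takes the same value. A regular curve is normal if it has finitely many self-intersections and each of them is a simple transversal crossing, i.e. the curve passes through the corresponding point exactly twice, with non-collinear (linearly independent over $\mathbb R$) tangent vectors. A Laurent polynomial $p\in\mathcal P_{m,n}$ is normal if the closed curve $\gamma(t)=p(e^{it})$, $0\le t\le 2\pi$ (parametrized by the circle), is normal; $\mathcal N_{m,n}\subset\mathcal P_{m,n}$ is the set of all normal $p$. *)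

theory Defs
  imports "HOL-Analysis.Analysis" "HOL-Library.Poly_Mapping"
begin

text \<open>
  Closed planar curves are \<open>2 * pi\<close>-periodic functions on \<open>\<real>\<close>; the half-open interval
  \<open>{0..<2*pi}\<close> contains each point of the parameter circle exactly once.
\<close>

definition C1_closed_curve :: "(real \<Rightarrow> complex) \<Rightarrow> bool" where
  "C1_closed_curve \<gamma> \<longleftrightarrow>
     \<gamma> C1_differentiable_on UNIV \<and> (\<forall>t. \<gamma> (t + 2 * pi) = \<gamma> t)"

definition regular_curve :: "(real \<Rightarrow> complex) \<Rightarrow> bool" where
  "regular_curve \<gamma> \<longleftrightarrow>
     C1_closed_curve \<gamma> \<and> (\<forall>t. vector_derivative \<gamma> (at t) \<noteq> 0)"

definition self_intersections :: "(real \<Rightarrow> complex) \<Rightarrow> real set set" where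
  "self_intersections \<gamma> =
     {{s, t} | s t. s \<in> {0..<2 * pi} \<and> t \<in> {0..<2 * pi} \<and> s \<noteq> t \<and> \<gamma> s = \<gamma> t}"

text \<open>
  Equal tangent vectors are excluded separately below because \<open>{v, v}\<close> is just the
  singleton \<open>{v}\<close>, which is independent as a set whenever \<open>v \<noteq> 0\<close>.
\<close>

definition simple_transversal_crossing :: "(real \<Rightarrow> complex) \<Rightarrow> real \<Rightarrow> real \<Rightarrow> bool" where
  "simple_transversal_crossing \<gamma> s t \<longleftrightarrow>
     {u \<in> {0..<2 * pi}. \<gamma> u = \<gamma> s} = {s, t} \<and>
     vector_derivative \<gamma> (at s) \<noteq> vector_derivative \<gamma> (at t) \<and>
     independent {vector_derivative \<gamma> (at s), vector_derivative \<gamma> (at t)}"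

definition normal_curve :: "(real \<Rightarrow> complex) \<Rightarrow> bool" where
  "normal_curve \<gamma> \<longleftrightarrow>
     regular_curve \<gamma> \<and>
     finite (self_intersections \<gamma>) \<and>
     (\<forall>s t. {s, t} \<in> self_intersections \<gamma> \<longrightarrow> simple_transversal_crossing \<gamma> s t)"

text \<open>
  A Laurent polynomial is a finitely supported family of coefficients indexed by the integers.
\<close>

type_synonym laurent_poly = "int \<Rightarrow>\<^sub>0 complex"

definition laurent_eval :: "laurent_poly \<Rightarrow> complex \<Rightarrow> complex" where
  "laurent_eval p z = (\<Sum>k\<in>Poly_Mapping.keys p. Poly_Mapping.lookup p k * z powi k)"

definition laurent_curve :: "laurent_poly \<Rightarrow> real \<Rightarrow> complex" where
  "laurent_curve p t = laurent_eval p (exp (\<i> * of_real t))"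

definition laurent_polys :: "int \<Rightarrow> int \<Rightarrow> laurent_poly set" where
  "laurent_polys m n =
     {p. Poly_Mapping.keys p \<subseteq> {m..n} \<and>
         Poly_Mapping.lookup p m \<noteq> 0 \<and> Poly_Mapping.lookup p n \<noteq> 0}"

definition coeff_vector :: "int \<Rightarrow> int \<Rightarrow> laurent_poly \<Rightarrow> int \<Rightarrow> complex" where
  "coeff_vector m n p = (\<lambda>k\<in>{m..n}. Poly_Mapping.lookup p k)"

text \<open>
  The space of coefficient vectors \<open>(a\<^sub>m, \<dots>, a\<^sub>n)\<close> carries the product topology
  of finitely many copies of \<open>\<complex>\<close>, which is its usual finite-dimensional topology.
\<close>

definition laurent_topology :: "int \<Rightarrow> int \<Rightarrow> laurent_poly topology" where
  "laurent_topology m n =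
     pullback_topology (laurent_polys m n) (coeff_vector m n)
       (product_topology (\<lambda>_. euclidean) {m..n})"

lemma topspace_laurent_topology [simp]: "topspace (laurent_topology m n) = laurent_polys m n"
  by (auto simp: laurent_topology_def topspace_pullback_topology coeff_vector_def)

definition normal_laurent_polys :: "int \<Rightarrow> int \<Rightarrow> laurent_poly set" where
  "normal_laurent_polys m n = {p \<in> laurent_polys m n. normal_curve (laurent_curve p)}"

end

theory Submission
  imports Defs
begin

text \<open>
  Write \<open>p(z) - p(y) = (z - y) Q(z, y)\<close>. A polynomial fails to be normal iff on the compact torus there
  are \<open>z, y\<close> with \<open>Q(z, y) = 0\<close> and collinear tangents (this includes \<open>z = y\<close>, where the tangent
  vanishes), or \<open>z, y, x\<close> with \<open>Q(z, y) = Q(z, x) = Q(y, x) = 0\<close>. Both conditions are closed, so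
  projecting along the compact factor gives openness.

  For density, perturb to \<open>p + v z^(k+1) + w z^k\<close> with \<open>k, k+1\<close> both nonzero. For almost all \<open>v\<close>,
  no double point has \<open>z^k = y^k\<close>, and then for almost all \<open>w\<close>: the curve is regular; no double point
  has \<open>z^(k+1) = y^(k+1)\<close>; every crossing is transversal, since the \<open>w\<close> that create a double point at
  \<open>(z, y)\<close> form a function of the two parameters whose critical values are the tangential ones (Sard);
  and there is no triple point, since triple points determine \<open>(v, w)\<close> smoothly from three real
  parameters, while \<open>(v, w)\<close> ranges over four real dimensions. If no such \<open>k\<close> is available, the
  exponents lie in \<open>{-1, 0, 1}\<close> and the curve is an ellipse, injective as soon as the coefficients of
  \<open>z\<close> and \<open>1/z\<close> have different moduli.
\<close>

section \<open>Null sets of parameters: dimension counts, Sard and Fubini\<close>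

text \<open>Solving for \<open>w\<close> gives \<open>w = - f s / g s\<close>, a differentiable
  curve, and a curve has measure zero in the plane.\<close>

lemma negligible_curve_zero_parameters:
  fixes f g :: "real \<Rightarrow> complex"
  assumes "\<And>s. f differentiable at s" "\<And>s. g differentiable at s"
  shows "negligible {w. \<exists>s. g s \<noteq> 0 \<and> f s + w * g s = 0}"
proof -
  have eq: "{w. \<exists>s. g s \<noteq> 0 \<and> f s + w * g s = 0} = (\<lambda>s. - f s / g s) ` {s. g s \<noteq> 0}"
  proof -
    have "f s + w * g s = 0 \<longleftrightarrow> w = - f s / g s" if "g s \<noteq> 0" for w s
      using that by (auto simp: field_simps add_eq_0_iff)
    then show ?thesis by (auto simp: image_iff)
  qed
  have "(\<lambda>s. - f s / g s) differentiable_on {s. g s \<noteq> 0}"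
    unfolding differentiable_on_def
    by (auto intro!: derivative_intros differentiable_divide assms intro: differentiable_at_withinI)
  then show ?thesis
    unfolding eq by (intro negligible_differentiable_image_lowdim) auto
qed

text \<open>\<open>Im (cnj A * B)\<close> is the determinant of \<open>A\<close> and
  \<open>B\<close> as vectors of the real plane. If it vanishes and \<open>A\<close> is nonzero,
  then \<open>B\<close> equals its own orthogonal projection onto the line through
  \<open>A\<close>.\<close>

lemma collinear_coefficients:
  fixes A B :: complex
  assumes "Im (cnj A * B) = 0"
  obtains a b :: real where "a \<noteq> 0 \<or> b \<noteq> 0" "of_real a * A = of_real b * B"
proof (cases "A = 0")
  case True
  then show ?thesis using that[of 1 0] by simp
next
  case False
  define r where "r = Re (cnj A * B) / (cmod A)\<^sup>2"
  have "of_real r * A = (cnj A * B) * A / of_real ((cmod A)\<^sup>2)"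
    using assms by (simp add: r_def complex_eq_iff)
  also have "\<dots> = B"
    using False unfolding complex_norm_square by (simp add: field_simps)
  finally show ?thesis using that[of r 1] by simp
qed

text \<open>The parameter creating a double point at \<open>(s, t)\<close> is \<open>W s t\<close>.
  Up to a nonzero factor, the partial derivatives of \<open>W\<close> are the tangents of the
  perturbed curve at \<open>s\<close> and at \<open>t\<close>, so a tangential double point is a
  critical point of \<open>W\<close>. By Sard the critical values form a null set.\<close>

lemma negligible_tangential_parameters:
  fixes g h g' h' :: "real \<Rightarrow> complex"
  assumes g: "\<And>s. (g has_vector_derivative g' s) (at s)"
    and h: "\<And>s. (h has_vector_derivative h' s) (at s)"
  shows "negligible {w. \<exists>s t. h s \<noteq> h t \<and> g s + w * h s = g t + w * h t \<and>
           Im (cnj (g' s + w * h' s) * (g' t + w * h' t)) = 0}"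
    (is "negligible ?N")
proof -
  define W where "W s t = - (g s - g t) / (h s - h t)" for s t
  define S where "S = {x::real^2. h (x$1) \<noteq> h (x$2) \<and>
      Im (cnj (g' (x$1) + W (x$1) (x$2) * h' (x$1)) * (g' (x$2) + W (x$1) (x$2) * h' (x$2))) = 0}"
  \<comment> \<open>The Sard theorem used below concerns maps between spaces of the form
    \<open>real^'n\<close>; \<open>\<phi>\<close> and \<open>\<psi>\<close> identify the complex
    plane with \<open>real^2\<close>.\<close>
  define \<phi> :: "complex \<Rightarrow> real^2" where "\<phi> z = (\<chi> i. if i = 1 then Re z else Im z)" for z
  define \<psi> :: "real^2 \<Rightarrow> complex" where "\<psi> x = Complex (x$1) (x$2)" for x
  define F where "F x = W (x$1) (x$2)" for x :: "real^2"
  define F' where "F' x d = - (of_real (d$1) * (g' (x$1) + F x * h' (x$1)) -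
      of_real (d$2) * (g' (x$2) + F x * h' (x$2))) / (h (x$1) - h (x$2))" for x d :: "real^2"
  have \<phi>: "bounded_linear \<phi>"
    unfolding \<phi>_def linear_conv_bounded_linear[symmetric]
    by (auto intro!: linearI simp: vec_eq_iff)
  have \<psi>: "bounded_linear \<psi>"
    unfolding \<psi>_def linear_conv_bounded_linear[symmetric]
    by (auto intro!: linearI simp: complex_eq_iff)
  have proj: "((\<lambda>x::real^2. f (x$i)) has_derivative (\<lambda>d. of_real (d$i) * f' (x$i))) (at x)"
    if "\<And>s. (f has_vector_derivative f' s) (at s)" for f f' :: "real \<Rightarrow> complex" and i x
  proof -
    have "((\<lambda>x::real^2. x$i) has_derivative (\<lambda>d. d$i)) (at x)"
      by (rule bounded_linear_imp_has_derivative) (rule bounded_linear_vec_nth)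
    from has_derivative_compose[OF this, of f "\<lambda>d. d *\<^sub>R f' (x$i)"] that
    show ?thesis by (simp add: has_vector_derivative_def scaleR_conv_of_real)
  qed
  have F: "(F has_derivative F' x) (at x)" if "h (x$1) \<noteq> h (x$2)" for x
  proof -
    have nz: "h (x$1) - h (x$2) \<noteq> 0" using that by simp
    \<comment> \<open>As \<open>- G / H\<close> is the value of \<open>F\<close>, the output of the
      quotient rule regroups into the perturbed tangents \<open>g' + F x * h'\<close>.\<close>
    have quotient_rule: "- (- G) * (inverse H * (a * h1 - b * h2) * inverse H) + - (a * g1 - b * g2) / H =
        - (a * (g1 + (- G / H) * h1) - b * (g2 + (- G / H) * h2)) / H" if "H \<noteq> 0"
      for G H a b g1 g2 h1 h2 :: complex
      using that by (simp add: field_simps)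
    show ?thesis
      unfolding F_def[abs_def] F'_def[abs_def] W_def
      by (rule has_derivative_eq_rhs, rule has_derivative_divide, rule has_derivative_minus,
          (rule has_derivative_diff, rule proj[OF g], rule proj[OF g],
           rule has_derivative_diff, rule proj[OF h], rule proj[OF h], rule nz),
          rule ext, rule quotient_rule[OF nz])
  qed
  have "negligible ((\<phi> \<circ> F) ` S)"
  proof (rule baby_Sard)
    fix x assume x: "x \<in> S"
    show der: "(\<phi> \<circ> F has_derivative \<phi> \<circ> F' x) (at x within S)"
      unfolding o_def
      by (rule bounded_linear.has_derivative[OF \<phi>], rule has_derivative_at_withinI, rule F)
        (use x in \<open>auto simp: S_def\<close>)
    obtain a b :: real where ab: "a \<noteq> 0 \<or> b \<noteq> 0"
      "of_real a * (g' (x$1) + F x * h' (x$1)) = of_real b * (g' (x$2) + F x * h' (x$2))"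
      using collinear_coefficients[of "g' (x$1) + F x * h' (x$1)" "g' (x$2) + F x * h' (x$2)"] x
      unfolding S_def F_def by blast
    \<comment> \<open>The coefficients of the collinearity relation form a kernel vector of the
      derivative.\<close>
    define d :: "real^2" where "d = (\<chi> i. if i = 1 then a else b)"
    have "d \<noteq> 0" using ab(1) by (auto simp: d_def vec_eq_iff forall_2)
    moreover have "F' x d = 0" using ab(2) by (simp add: F'_def d_def)
    then have "matrix (\<phi> \<circ> F' x) *v d = matrix (\<phi> \<circ> F' x) *v 0"
      using has_derivative_linear[OF der] F'_def[of x 0]
      by (simp add: matrix_works bounded_linear.linear[OF \<phi>] linear_0)
    ultimately have "\<not> inj ((*v) (matrix (\<phi> \<circ> F' x)))"
      unfolding inj_def by blast
    then show "rank (matrix (\<phi> \<circ> F' x)) < CARD(2)"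
      by (rule iffD2[OF less_rank_noninjective])
  qed simp
  then have "negligible (\<psi> ` (\<phi> \<circ> F) ` S)"
    by (rule negligible_differentiable_image_negligible[rotated])
      (auto intro: bounded_linear_imp_differentiable_on \<psi>)
  moreover have "\<psi> (\<phi> z) = z" for z by (simp add: \<phi>_def \<psi>_def)
  ultimately have "negligible (F ` S)" by (simp add: image_image)
  moreover have "?N \<subseteq> F ` S"
  proof clarify
    fix w s t
    assume *: "h s \<noteq> h t" "g s + w * h s = g t + w * h t"
      "Im (cnj (g' s + w * h' s) * (g' t + w * h' t)) = 0"
    define x :: "real^2" where "x = (\<chi> i. if i = 1 then s else t)"
    have x: "x$1 = s" "x$2 = t" by (simp_all add: x_def)
    have w: "w = W s t" using *(1,2) by (simp add: W_def field_simps)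
    show "w \<in> F ` S"
      by (rule image_eqI[of _ _ x]) (use * in \<open>auto simp: S_def F_def x w[symmetric]\<close>)
  qed
  ultimately show ?thesis by (rule negligible_subset)
qed

text \<open>The two coincidences are a linear system for \<open>(v, w)\<close> with nonzero
  determinant. By Cramer's rule, which is the formula for \<open>F\<close>, its solution is a
  differentiable function of three real parameters, and the image is null in four real
  dimensions.\<close>

lemma negligible_triple_parameters:
  fixes f g h :: "real \<Rightarrow> complex"
  assumes f: "\<And>s. f differentiable at s" and g: "\<And>s. g differentiable at s"
    and h: "\<And>s. h differentiable at s"
  shows "negligible {(v, w). \<exists>s t u.
           (g s - g t) * (h s - h u) \<noteq> (g s - g u) * (h s - h t) \<and>
           f s + v * g s + w * h s = f t + v * g t + w * h t \<and>
           f s + v * g s + w * h s = f u + v * g u + w * h u}"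
    (is "negligible ?N")
proof -
  define G where "G x = (let (s, t, u) = x in g s - g t)" for x :: "real \<times> real \<times> real"
  define G' where "G' x = (let (s, t, u) = x in g s - g u)" for x :: "real \<times> real \<times> real"
  define H where "H x = (let (s, t, u) = x in h s - h t)" for x :: "real \<times> real \<times> real"
  define H' where "H' x = (let (s, t, u) = x in h s - h u)" for x :: "real \<times> real \<times> real"
  define P where "P x = (let (s, t, u) = x in f s - f t)" for x :: "real \<times> real \<times> real"
  define P' where "P' x = (let (s, t, u) = x in f s - f u)" for x :: "real \<times> real \<times> real"
  note defs = G_def G'_def H_def H'_def P_def P'_def
  define S where "S = {x. G x * H' x - G' x * H x \<noteq> 0}"
  define F where "F x = ((P' x * H x - P x * H' x) / (G x * H' x - G' x * H x),
                         (G' x * P x - G x * P' x) / (G x * H' x - G' x * H x))" for x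
  have proj: "(\<lambda>x::real\<times>real\<times>real. q (fst x)) differentiable (at x)"
      "(\<lambda>x::real\<times>real\<times>real. q (fst (snd x))) differentiable (at x)"
      "(\<lambda>x::real\<times>real\<times>real. q (snd (snd x))) differentiable (at x)"
    if "\<And>s. q differentiable at s" for q :: "real \<Rightarrow> complex" and x
    by (rule differentiable_compose[of q, OF that],
        rule bounded_linear_imp_differentiable,
        rule bounded_linear_fst bounded_linear_snd
        bounded_linear_compose[OF bounded_linear_fst bounded_linear_snd]
        bounded_linear_compose[OF bounded_linear_snd bounded_linear_snd])+
  have diff: "G differentiable (at x)" "G' differentiable (at x)" "H differentiable (at x)"
     "H' differentiable (at x)" "P differentiable (at x)" "P' differentiable (at x)" for x
    unfolding defs case_prod_unfold Let_def
    by (intro differentiable_diff proj f g h)+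
  have "F differentiable_on S"
    unfolding differentiable_on_def F_def
    by (auto simp: S_def intro!: differentiable_Pair differentiable_divide
        differentiable_diff differentiable_mult differentiable_at_withinI[OF diff(1)]
        differentiable_at_withinI[OF diff(2)] differentiable_at_withinI[OF diff(3)]
        differentiable_at_withinI[OF diff(4)] differentiable_at_withinI[OF diff(5)]
        differentiable_at_withinI[OF diff(6)])
  then have "negligible (F ` S)"
    by (intro negligible_differentiable_image_lowdim) auto
  moreover have "?N \<subseteq> F ` S"
  proof clarify
    fix v w s t u
    assume det: "(g s - g t) * (h s - h u) \<noteq> (g s - g u) * (h s - h t)"
      and e1: "f s + v * g s + w * h s = f t + v * g t + w * h t"
      and e2: "f s + v * g s + w * h s = f u + v * g u + w * h u"
    have p: "f s - f t = - (v * (g s - g t)) - w * (h s - h t)"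
      "f s - f u = - (v * (g s - g u)) - w * (h s - h u)"
      using e1 e2 by algebra+
    show "(v, w) \<in> F ` S"
      by (rule image_eqI[of _ _ "(s,t,u)"]) (use det in
          \<open>auto simp: S_def F_def defs eq_divide_eq p algebra_simps\<close>)
  qed
  ultimately show ?thesis by (rule negligible_subset)
qed

text \<open>Fubini for null sets. A negligible set need not be Borel, so \<open>N\<close> is first
  enlarged to a Borel null set \<open>N'\<close>, whose sections are null almost everywhere.\<close>

lemma negligible_negligible_sections:
  fixes N :: "('a::euclidean_space \<times> 'b::euclidean_space) set"
  assumes "negligible N"
  shows "negligible {v. \<not> negligible {w. (v, w) \<in> N}}"
proof -
  obtain N' where N': "N \<subseteq> N'" "N' \<in> null_sets lborel"
    using assms by (auto simp: negligible_iff_null_sets null_sets_completion_iff2)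
  have "AE x in lborel. x \<notin> N'"
    using N'(2) by (rule AE_not_in)
  then have "AE x in lborel \<Otimes>\<^sub>M lborel. x \<notin> N'"
    by (subst lborel_prod)
  then have "AE v in lborel. AE w in lborel. (v, w) \<notin> N'"
    by (rule lborel_pair.AE_pair)
  then obtain M where M: "M \<in> null_sets lborel" "{v. \<not> (AE w in lborel. (v, w) \<notin> N')} \<subseteq> M"
    by (auto simp: eventually_ae_filter)
  have "{v. \<not> negligible {w. (v, w) \<in> N}} \<subseteq> M"
  proof (rule ccontr)
    assume "\<not> ?thesis"
    then obtain v where v: "\<not> negligible {w. (v, w) \<in> N}" "v \<notin> M" by auto
    then have "AE w in lborel. (v, w) \<notin> N'" using M(2) by auto
    then obtain K where K: "K \<in> null_sets lborel" "{w. (v, w) \<in> N'} \<subseteq> K"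
      by (auto simp: eventually_ae_filter)
    then have "negligible {w. (v, w) \<in> N}"
      using N'(1) unfolding negligible_iff_null_sets null_sets_completion_iff2 by blast
    with v show False by simp
  qed
  then show ?thesis
    using M(1) by (auto simp: negligible_iff_null_sets null_sets_completion_iff2)
qed

section \<open>Laurent sums on the unit circle\<close>

definition laurent_sum :: "int \<Rightarrow> int \<Rightarrow> (int \<Rightarrow> complex) \<Rightarrow> complex \<Rightarrow> complex" where
  "laurent_sum m n a z = (\<Sum>k=m..n. a k * z powi k)"

text \<open>The derivative of \<open>laurent_sum m n a (cis s)\<close> with respect to
  \<open>s\<close>, written as a function of \<open>z = cis s\<close>.\<close>

definition laurent_tangent :: "int \<Rightarrow> int \<Rightarrow> (int \<Rightarrow> complex) \<Rightarrow> complex \<Rightarrow> complex" where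
  "laurent_tangent m n a z = (\<Sum>k=m..n. a k * (\<i> * of_int k * z powi k))"

text \<open>Normality in terms of points of the circle instead of parameters. Finiteness of the
  double points is left out because it follows from the other conditions; see
  \<open>finite_double_points\<close>.\<close>

definition generic_coeffs :: "int \<Rightarrow> int \<Rightarrow> (int \<Rightarrow> complex) \<Rightarrow> bool" where
  "generic_coeffs m n a \<longleftrightarrow>
     (\<forall>z\<in>sphere 0 1. laurent_tangent m n a z \<noteq> 0) \<and>
     (\<forall>z\<in>sphere 0 1. \<forall>y\<in>sphere 0 1. z \<noteq> y \<and> laurent_sum m n a z = laurent_sum m n a y \<longrightarrow>
        Im (cnj (laurent_tangent m n a z) * laurent_tangent m n a y) \<noteq> 0) \<and>
     (\<forall>z\<in>sphere 0 1. \<forall>y\<in>sphere 0 1. \<forall>x\<in>sphere 0 1. z \<noteq> y \<and> z \<noteq> x \<and> y \<noteq> x \<longrightarrow>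
        \<not> (laurent_sum m n a z = laurent_sum m n a y \<and> laurent_sum m n a z = laurent_sum m n a x))"

lemma sphere_eq_range_cis: "sphere 0 1 = range cis"
proof (intro set_eqI iffI)
  fix z :: complex assume "z \<in> sphere 0 1"
  then show "z \<in> range cis"
    using rcis_cmod_Arg[of z] by (metis dist_0_norm mem_sphere mult_1 of_real_1 rangeI rcis_def)
qed auto

lemma has_vector_derivative_cis_powi:
  "((\<lambda>s. cis s powi k) has_vector_derivative \<i> * of_int k * cis s powi k) (at s)"
proof -
  have "((\<lambda>z. exp (\<i> * of_int k * z)) has_field_derivative \<i> * of_int k * exp (\<i> * of_int k * of_real s))
          (at (of_real s))"
    by (auto intro!: derivative_eq_intros)
  from has_vector_derivative_real_field[OF this]
  show ?thesis
    unfolding cis_power_int by (simp add: cis_conv_exp mult_ac)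
qed

lemma has_vector_derivative_laurent_sum_cis:
  "((\<lambda>s. laurent_sum m n a (cis s)) has_vector_derivative laurent_tangent m n a (cis s)) (at s)"
  unfolding laurent_sum_def laurent_tangent_def
  by (intro has_vector_derivative_sum has_vector_derivative_mult_right has_vector_derivative_cis_powi)

lemma differentiable_cis_powi: "(\<lambda>s. cis s powi k) differentiable (at s)"
  using has_vector_derivative_cis_powi by (rule differentiableI_vector)

lemma differentiable_laurent_sum_cis: "(\<lambda>s. laurent_sum m n a (cis s)) differentiable (at s)"
  using has_vector_derivative_laurent_sum_cis by (rule differentiableI_vector)

lemma laurent_tangent_eq_laurent_sum:
  "laurent_tangent m n a = laurent_sum m n (\<lambda>k. a k * (\<i> * of_int k))"
  by (simp add: fun_eq_iff laurent_tangent_def laurent_sum_def mult_ac)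

text \<open>A rotation of the argument is absorbed by the coefficients, so differentiability of
  Laurent sums also covers rotated copies of the curve.\<close>

lemma laurent_sum_mult_arg:
  "laurent_sum m n a (\<zeta> * z) = laurent_sum m n (\<lambda>k. a k * \<zeta> powi k) z"
  by (simp add: laurent_sum_def power_int_mult_distrib mult_ac)

lemma laurent_sum_perturb:
  assumes "k \<in> {m..n}"
  shows "laurent_sum m n (a(k := a k + w)) z = laurent_sum m n a z + w * z powi k"
    and "laurent_tangent m n (a(k := a k + w)) z =
           laurent_tangent m n a z + w * (\<i> * of_int k * z powi k)"
  using assms by (simp_all add: laurent_sum_def laurent_tangent_def
      sum.remove[of "{m..n}" k] distrib_right)

section \<open>Density of generic coefficients\<close>

text \<open>
  Linear independence of the two equations for \<open>(v, w)\<close> at a triple point: with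
  \<open>X = x^k\<close> etc., a vanishing determinant forces \<open>z^k = x^k\<close> or \<open>z^(k+1) = x^(k+1)\<close>.
\<close>

lemma unit_triple_det_zero:
  fixes x y z X Y Z :: complex
  assumes "x \<in> sphere 0 1" "y \<in> sphere 0 1" "z \<in> sphere 0 1"
    and "X \<in> sphere 0 1" "Y \<in> sphere 0 1" "Z \<in> sphere 0 1"
    and "z \<noteq> y" "x \<noteq> y"
    and det: "(z * Z - y * Y) * (Z - X) = (z * Z - x * X) * (Z - Y)"
  shows "Z = X \<or> z * Z = x * X"
proof -
  have nz: "x \<noteq> 0" "y \<noteq> 0" "z \<noteq> 0" "X \<noteq> 0" "Y \<noteq> 0" "Z \<noteq> 0"
    using assms by auto
  have cnj: "cnj u = inverse u" if "u \<in> sphere 0 1" for u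
    using that by (simp add: inverse_complex_def divide_inverse complex_eq_iff cmod_power2[symmetric])
  have E1: "X * Z * (z - x) + X * Y * (x - y) + Y * Z * (y - z) = 0"
    using det by algebra
  \<comment> \<open>Conjugation inverts unit complex numbers, which gives a second independent relation.\<close>
  then have "cnj (X * Z * (z - x) + X * Y * (x - y) + Y * Z * (y - z)) = 0"
    by (simp only: complex_cnj_zero)
  then have "inverse X * inverse Z * (inverse z - inverse x) +
      inverse X * inverse Y * (inverse x - inverse y) +
      inverse Y * inverse Z * (inverse y - inverse z) = 0"
    using assms by (simp add: cnj)
  moreover have "y * Y * (x - z) + z * Z * (y - x) + x * X * (z - y) =
      X * Y * Z * x * y * z * (inverse X * inverse Z * (inverse z - inverse x) +
      inverse X * inverse Y * (inverse x - inverse y) +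
      inverse Y * inverse Z * (inverse y - inverse z))"
    using nz by (simp add: field_simps)
  ultimately have E2: "y * Y * (x - z) + z * Z * (y - x) + x * X * (z - y) = 0"
    by simp
  have "(Z - X) * (z * Z - x * X) * ((z - y) * (x - y)) = 0"
    using E1 E2 by algebra
  then show ?thesis using assms by simp
qed

text \<open>If \<open>z powi k = y powi k\<close>, then \<open>y = \<zeta> * z\<close> for one of
  finitely many roots of unity. For a fixed \<open>\<zeta>\<close> only one real parameter is left,
  so the bad \<open>v\<close> lie on a curve.\<close>

lemma negligible_root_of_unity_double_points:
  fixes k l :: int
  assumes "k \<noteq> 0"
  shows "negligible {v. \<exists>z\<in>sphere 0 1. \<exists>y\<in>sphere 0 1. z powi k = y powi k \<and> z powi l \<noteq> y powi l \<and>
           laurent_sum m n a z + v * z powi l = laurent_sum m n a y + v * y powi l}"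
    (is "negligible ?N")
proof -
  define R where "R = {\<zeta>::complex. \<zeta> ^ nat \<bar>k\<bar> = 1}"
  \<comment> \<open>For \<open>z = cis s\<close> and \<open>y = \<zeta> * z\<close>, the factor of
    \<open>v\<close> is \<open>z powi l - y powi l\<close>.\<close>
  define M where "M \<zeta> = {v. \<exists>s. cis s powi l * (1 - \<zeta> powi l) \<noteq> 0 \<and>
      (laurent_sum m n a (cis s) - laurent_sum m n a (\<zeta> * cis s)) +
       v * (cis s powi l * (1 - \<zeta> powi l)) = 0}" for \<zeta>
  have "negligible (\<Union>(M ` R))"
  proof (rule negligible_Union)
    show "finite (M ` R)"
      unfolding R_def using assms by (intro finite_imageI finite_nth_roots) auto
    fix T assume "T \<in> M ` R"
    then obtain \<zeta> where T: "T = M \<zeta>" by auto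
    show "negligible T"
      unfolding T M_def laurent_sum_mult_arg
      by (intro negligible_curve_zero_parameters differentiable_diff differentiable_mult
          differentiable_laurent_sum_cis differentiable_cis_powi differentiable_const)
  qed
  moreover have "?N \<subseteq> \<Union>(M ` R)"
  proof clarify
    fix v z y :: complex
    assume zy: "z \<in> sphere 0 1" "y \<in> sphere 0 1" "z powi k = y powi k" "z powi l \<noteq> y powi l"
      and eq: "laurent_sum m n a z + v * z powi l = laurent_sum m n a y + v * y powi l"
    define \<zeta> where "\<zeta> = y / z"
    have nz: "z \<noteq> 0" "y \<noteq> 0" using zy by auto
    have y: "y = \<zeta> * z" using nz by (simp add: \<zeta>_def)
    have "\<zeta> powi k = 1" using zy(3) nz by (simp add: \<zeta>_def power_int_divide_distrib)
    then have "\<zeta> \<in> R"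
      by (auto simp: R_def power_int_def power_inverse abs_if split: if_splits)
    moreover obtain s where s: "z = cis s" using zy(1) by (auto simp: sphere_eq_range_cis)
    have yl: "y powi l = \<zeta> powi l * z powi l" by (simp add: y power_int_mult_distrib)
    have "v \<in> M \<zeta>"
      unfolding M_def mem_Collect_eq s[symmetric] y[symmetric]
      by (rule exI[of _ s]) (use zy(4) eq in \<open>simp add: s[symmetric] y[symmetric] yl algebra_simps\<close>)
    ultimately show "v \<in> \<Union>(M ` R)" by blast
  qed
  ultimately show ?thesis by (rule negligible_subset)
qed

lemma not_negligible_ball_diff:
  fixes x :: "'a::euclidean_space"
  assumes "e > 0" "negligible N"
  obtains y where "y \<in> ball x e" "y \<notin> N"
proof -
  have "\<not> negligible (ball x e)"
    using assms by (intro open_not_negligible) auto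
  then show ?thesis using assms(2) negligible_subset that by blast
qed

text \<open>The exponents are consecutive so that \<open>z powi k\<close> and
  \<open>z powi (k + 1)\<close> together determine \<open>z\<close> on the circle. First
  \<open>v\<close> is chosen such that double points with equal \<open>k\<close>-th powers are
  excluded for every \<open>w\<close> and almost every \<open>w\<close> avoids triple points; then
  \<open>w\<close> has to avoid four null sets that depend on \<open>v\<close>.\<close>

lemma generic_perturbation_consecutive:
  fixes k :: int
  assumes k: "k \<in> {m..n}" "k + 1 \<in> {m..n}" "k \<noteq> 0" "k + 1 \<noteq> 0" and e: "e > 0"
  obtains v w where "cmod v < e" "cmod w < e"
    "generic_coeffs m n ((a(k+1 := a (k+1) + v))(k := a k + w))"
proof -
  define l where "l = k + 1"
  have powl: "z powi l = z * z powi k" if "z \<in> sphere 0 1" for z :: complex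
  proof -
    have "z \<noteq> 0" using that by auto
    then show ?thesis by (simp add: l_def power_int_add)
  qed
  let ?L = "laurent_sum m n a"
  have trip: "negligible {(v, w). \<exists>s t u.
      (cis s powi l - cis t powi l) * (cis s powi k - cis u powi k) \<noteq>
      (cis s powi l - cis u powi l) * (cis s powi k - cis t powi k) \<and>
      ?L (cis s) + v * cis s powi l + w * cis s powi k = ?L (cis t) + v * cis t powi l + w * cis t powi k \<and>
      ?L (cis s) + v * cis s powi l + w * cis s powi k = ?L (cis u) + v * cis u powi l + w * cis u powi k}"
    (is "negligible ?T")
    by (intro negligible_triple_parameters differentiable_laurent_sum_cis differentiable_cis_powi)
  have rotk: "negligible {v. \<exists>z\<in>sphere 0 1. \<exists>y\<in>sphere 0 1. z powi k = y powi k \<and> z powi l \<noteq> y powi l \<and>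
      ?L z + v * z powi l = ?L y + v * y powi l}" (is "negligible ?A")
    by (rule negligible_root_of_unity_double_points) fact
  have "negligible ({v. \<not> negligible {w. (v, w) \<in> ?T}} \<union> ?A)"
    by (intro negligible_Un negligible_negligible_sections[OF trip] rotk)
  then obtain v where v: "v \<in> ball 0 e" "v \<notin> {v. \<not> negligible {w. (v, w) \<in> ?T}} \<union> ?A"
    by (rule not_negligible_ball_diff[OF e])
  define a1 where "a1 = a(l := a l + v)"
  have a1: "laurent_sum m n a1 z = ?L z + v * z powi l" for z
    unfolding a1_def using k by (intro laurent_sum_perturb) (simp add: l_def)
  let ?L1 = "laurent_sum m n a1" and ?D1 = "laurent_tangent m n a1"
  have rotl: "negligible {w. \<exists>z\<in>sphere 0 1. \<exists>y\<in>sphere 0 1. z powi l = y powi l \<and> z powi k \<noteq> y powi k \<and>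
      ?L1 z + w * z powi k = ?L1 y + w * y powi k}" (is "negligible ?B")
    by (rule negligible_root_of_unity_double_points) (use k in \<open>simp add: l_def\<close>)
  have reg: "negligible {w. \<exists>s. \<i> * of_int k * cis s powi k \<noteq> 0 \<and>
      ?D1 (cis s) + w * (\<i> * of_int k * cis s powi k) = 0}" (is "negligible ?C")
    unfolding laurent_tangent_eq_laurent_sum
    by (intro negligible_curve_zero_parameters differentiable_laurent_sum_cis differentiable_mult
        differentiable_cis_powi differentiable_const)
  have tang: "negligible {w. \<exists>s t. cis s powi k \<noteq> cis t powi k \<and>
      ?L1 (cis s) + w * cis s powi k = ?L1 (cis t) + w * cis t powi k \<and>
      Im (cnj (?D1 (cis s) + w * (\<i> * of_int k * cis s powi k)) *
         (?D1 (cis t) + w * (\<i> * of_int k * cis t powi k))) = 0}" (is "negligible ?E")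
    by (intro negligible_tangential_parameters has_vector_derivative_laurent_sum_cis
        has_vector_derivative_cis_powi)
  have "negligible {w. (v, w) \<in> ?T}" using v(2) by blast
  then have "negligible ({w. (v, w) \<in> ?T} \<union> (?B \<union> (?C \<union> ?E)))"
    by (intro negligible_Un rotl reg tang)
  then obtain w where w: "w \<in> ball 0 e" "w \<notin> {w. (v, w) \<in> ?T} \<union> (?B \<union> (?C \<union> ?E))"
    by (rule not_negligible_ball_diff[OF e])
  define b where "b = a1(k := a1 k + w)"
  have b: "laurent_sum m n b z = ?L1 z + w * z powi k"
    "laurent_tangent m n b z = ?D1 z + w * (\<i> * of_int k * z powi k)" for z
    unfolding b_def using k by (simp_all only: laurent_sum_perturb)
  \<comment> \<open>If the \<open>k\<close>-th powers agree, the terms with \<open>w\<close> cancel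
    and the double point is present before \<open>w\<close> is added, which the choice of
    \<open>v\<close> forbids.\<close>
  have distinct_k: "z powi k \<noteq> y powi k"
    if "z \<in> sphere 0 1" "y \<in> sphere 0 1" "z \<noteq> y" "laurent_sum m n b z = laurent_sum m n b y" for z y
  proof
    assume eq: "z powi k = y powi k"
    have "y powi k \<noteq> 0" using that by auto
    then have "z powi l \<noteq> y powi l" using that eq by (simp add: powl)
    moreover have "?L z + v * z powi l = ?L y + v * y powi l"
      using that(4) by (simp add: a1 b eq)
    ultimately show False using v(2) that(1,2) eq by blast
  qed
  \<comment> \<open>The set \<open>?B\<close> only excludes pairs whose \<open>k\<close>-th powers
    differ; \<open>distinct_k\<close> supplies this.\<close>
  have distinct_l: "z powi l \<noteq> y powi l"
    if "z \<in> sphere 0 1" "y \<in> sphere 0 1" "z \<noteq> y" "laurent_sum m n b z = laurent_sum m n b y" for z y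
  proof
    assume eq: "z powi l = y powi l"
    moreover have "?L1 z + w * z powi k = ?L1 y + w * y powi k"
      using that(4) by (simp add: b)
    ultimately show False using w(2) that(1,2) distinct_k[OF that] by blast
  qed
  have "generic_coeffs m n b"
    unfolding generic_coeffs_def
  proof (intro conjI ballI impI)
    fix z :: complex assume "z \<in> sphere 0 1"
    then obtain s where s: "z = cis s" by (auto simp: sphere_eq_range_cis)
    have "\<i> * of_int k * cis s powi k \<noteq> 0" using k by simp
    then show "laurent_tangent m n b z \<noteq> 0" using w(2) unfolding b s by blast
  next
    fix z y :: complex assume zy: "z \<in> sphere 0 1" "y \<in> sphere 0 1"
      and eq: "z \<noteq> y \<and> laurent_sum m n b z = laurent_sum m n b y"
    obtain s t where st: "z = cis s" "y = cis t" using zy by (auto simp: sphere_eq_range_cis)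
    have "z powi k \<noteq> y powi k" using distinct_k zy eq by blast
    then show "Im (cnj (laurent_tangent m n b z) * laurent_tangent m n b y) \<noteq> 0"
      using w(2) conjunct2[OF eq] unfolding b st by blast
  next
    fix z y x :: complex assume zyx: "z \<in> sphere 0 1" "y \<in> sphere 0 1" "x \<in> sphere 0 1"
      and ne: "z \<noteq> y \<and> z \<noteq> x \<and> y \<noteq> x"
    obtain s t u where stu: "z = cis s" "y = cis t" "x = cis u"
      using zyx by (auto simp: sphere_eq_range_cis)
    show "\<not> (laurent_sum m n b z = laurent_sum m n b y \<and> laurent_sum m n b z = laurent_sum m n b x)"
    proof
      assume eq: "laurent_sum m n b z = laurent_sum m n b y \<and> laurent_sum m n b z = laurent_sum m n b x"
      have unit: "q powi k \<in> sphere 0 1" if "q \<in> sphere 0 1" for q :: complex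
        using that by (simp add: norm_power_int)
      \<comment> \<open>If this determinant vanished, \<open>z\<close> and \<open>x\<close> would
        have equal \<open>k\<close>-th or equal \<open>l\<close>-th powers, which is impossible at a
        double point.\<close>
      have "(z powi l - y powi l) * (z powi k - x powi k) \<noteq> (z powi l - x powi l) * (z powi k - y powi k)"
      proof
        assume "(z powi l - y powi l) * (z powi k - x powi k) = (z powi l - x powi l) * (z powi k - y powi k)"
        then have "(z * z powi k - y * y powi k) * (z powi k - x powi k) =
            (z * z powi k - x * x powi k) * (z powi k - y powi k)"
          using zyx by (simp only: powl)
        then have "z powi k = x powi k \<or> z powi l = x powi l"
          using unit_triple_det_zero[of x y z "x powi k" "y powi k" "z powi k"] zyx ne unit
          by (simp only: powl) blast
        then show False using distinct_k distinct_l zyx ne eq by blast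
      qed
      then have "(v, w) \<in> ?T"
        using eq unfolding b a1 stu by blast
      then show False using w(2) by blast
    qed
  qed
  moreover have "b = (a(k+1 := a (k+1) + v))(k := a k + w)"
    by (simp add: b_def a1_def l_def)
  ultimately show ?thesis using that[of v w] v(1) w(1) by simp
qed

text \<open>The curve is \<open>a 0 + d * z + c / z\<close>. On the circle \<open>1/z - 1/y\<close>
  and \<open>z - y\<close> have the same modulus, so a double point would force
  \<open>cmod c = cmod d\<close>, and so would a vanishing tangent. The conditions on double and
  triple points are then vacuous.\<close>

lemma generic_if_unequal_moduli:
  assumes mn: "m < n" "{m..n} \<subseteq> {-1..1}"
    and ne: "cmod (if m = -1 then a (-1) else 0) \<noteq> cmod (if n = 1 then a 1 else 0)"
  shows "generic_coeffs m n a"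
proof -
  \<comment> \<open>An exponent outside the range counts with coefficient 0, which treats the ranges
    \<open>{-1..0}\<close>, \<open>{0..1}\<close> and \<open>{-1..1}\<close> together.\<close>
  define c where "c = (if m = -1 then a (-1) else 0)"
  define d where "d = (if n = 1 then a 1 else 0)"
  have "m = -1 \<and> n = 0 \<or> m = -1 \<and> n = 1 \<or> m = 0 \<and> n = 1"
  proof -
    have "m \<in> {-1..1}" "n \<in> {-1..1}" using mn by (auto simp: subset_iff)
    then show ?thesis using mn(1) by auto
  qed
  moreover have "{-1..0::int} = {-1,0}" "{-1..1::int} = {-1,0,1}" "{0..1::int} = {0,1}" by auto
  ultimately have eqs: "laurent_sum m n a z = c * inverse z + (a 0 + d * z)"
     "laurent_tangent m n a z = \<i> * (d * z - c * inverse z)" for z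
    unfolding laurent_sum_def laurent_tangent_def c_def d_def
    by (auto simp: power_int_def algebra_simps)
  have inj: "z = y" if zy: "z \<in> sphere 0 1" "y \<in> sphere 0 1"
    and eq: "laurent_sum m n a z = laurent_sum m n a y" for z y
  proof (rule ccontr)
    assume "z \<noteq> y"
    have "c * (inverse z - inverse y) = - d * (z - y)"
      using eq unfolding eqs by (simp add: algebra_simps)
    then have "cmod c * cmod (inverse z - inverse y) = cmod d * cmod (z - y)"
      by (metis norm_minus_cancel norm_mult)
    moreover have "cmod (inverse z - inverse y) = cmod (z - y)"
    proof -
      have "z \<noteq> 0" "y \<noteq> 0" using zy by auto
      then have "inverse z - inverse y = (y - z) / (z * y)" by (simp add: field_simps)
      then show ?thesis using zy by (simp add: norm_divide norm_mult norm_minus_commute)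
    qed
    ultimately show False using \<open>z \<noteq> y\<close> ne unfolding c_def d_def by simp
  qed
  have "laurent_tangent m n a z \<noteq> 0" if "z \<in> sphere 0 1" for z
  proof
    assume "laurent_tangent m n a z = 0"
    then have "d * z = c * inverse z" unfolding eqs by simp
    then have "cmod (d * z) = cmod (c * inverse z)" by simp
    then show False using ne that unfolding c_def[symmetric] d_def[symmetric]
      by (simp add: norm_mult norm_inverse)
  qed
  then show ?thesis unfolding generic_coeffs_def using inj by blast
qed

lemma generic_coeffs_dense:
  assumes mn: "m < n" and "a m \<noteq> 0" "a n \<noteq> 0" and e: "e > 0"
  obtains b where "generic_coeffs m n b" "\<And>i. cmod (b i - a i) < e"
proof (cases "{m..n} \<subseteq> {-1..1}")
  case False
  then have "m < -1 \<or> n > 1" by auto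
  \<comment> \<open>Two consecutive nonzero exponents exist at the bottom end if
    \<open>m < -1\<close> and at the top end if \<open>n > 1\<close>.\<close>
  then obtain k where k: "k \<in> {m..n}" "k + 1 \<in> {m..n}" "k \<noteq> 0" "k + 1 \<noteq> 0"
  proof
    assume "m < -1" then show thesis using that[of m] mn by auto
  next
    assume "n > 1" then show thesis using that[of "n - 1"] mn by auto
  qed
  obtain v w where "cmod v < e" "cmod w < e"
    "generic_coeffs m n ((a(k+1 := a (k+1) + v))(k := a k + w))"
    using generic_perturbation_consecutive[OF k e] .
  then show ?thesis using e by (intro that[of "(a(k+1 := a (k+1) + v))(k := a k + w)"]) auto
next
  case True
  show ?thesis
  proof (cases "cmod (if m = -1 then a (-1) else 0) = cmod (if n = 1 then a 1 else 0)")
    case False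
    then show ?thesis using generic_if_unequal_moduli[OF mn True] e by (intro that[of a]) auto
  next
    case eq: True
    have "m = -1 \<or> n = 1"
    proof -
      have "m \<in> {-1..1}" "n \<in> {-1..1}" using mn True by (auto simp: subset_iff)
      then show ?thesis using mn by auto
    qed
    \<comment> \<open>If only one of the exponents -1 and 1 occurred, it would be an end of the
      range, and equal moduli would make that end coefficient 0.\<close>
    then have mn': "m = -1" "n = 1" using eq assms(2,3) by (auto split: if_splits)
    \<comment> \<open>A perturbation in the direction of \<open>a 1\<close>, which raises its
      modulus by exactly \<open>e / 2\<close>.\<close>
    define w where "w = a 1 * of_real (e / (2 * cmod (a 1)))"
    have nz: "a 1 \<noteq> 0" using assms mn' by simp
    have "cmod w = e / 2" using nz e unfolding w_def norm_mult norm_of_real by simp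
    have "a 1 + w = a 1 * of_real (1 + e / (2 * cmod (a 1)))"
      by (simp add: w_def algebra_simps)
    then have "cmod (a 1 + w) = cmod (a 1) * (1 + e / (2 * cmod (a 1)))"
      using e by (simp add: norm_mult del: of_real_add)
    then have "cmod (a 1 + w) = cmod (a 1) + e / 2" using nz by (simp add: distrib_left)
    then have "generic_coeffs m n (a(1 := a 1 + w))"
      using eq e mn' by (intro generic_if_unequal_moduli mn True) auto
    then show ?thesis using \<open>cmod w = e / 2\<close> e by (intro that[of "a(1 := a 1 + w)"]) auto
  qed
qed

section \<open>Difference quotients and closedness of the nongeneric set\<close>

text \<open>The quotient of \<open>z powi k - y powi k\<close> by \<open>z - y\<close>, in a
  division-free form that also makes sense on the diagonal. For negative \<open>k\<close> it rests
  on \<open>1/z^N - 1/y^N = - (z^N - y^N) / (z * y)^N\<close>.\<close>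

definition powi_quotient :: "int \<Rightarrow> complex \<Rightarrow> complex \<Rightarrow> complex" where
  "powi_quotient k z y =
     (if k \<ge> 0 then \<Sum>i<nat k. y ^ (nat k - Suc i) * z ^ i
      else - (\<Sum>i<nat (-k). y ^ (nat (-k) - Suc i) * z ^ i) * (z * y) powi k)"

definition laurent_quotient :: "int \<Rightarrow> int \<Rightarrow> (int \<Rightarrow> complex) \<Rightarrow> complex \<Rightarrow> complex \<Rightarrow> complex" where
  "laurent_quotient m n a z y = (\<Sum>k=m..n. a k * powi_quotient k z y)"

lemma powi_diff_eq:
  assumes "z \<noteq> 0" "y \<noteq> 0"
  shows "z powi k - y powi k = (z - y) * powi_quotient k z y"
proof (cases "k \<ge> 0")
  case True
  then show ?thesis
    by (simp add: powi_quotient_def power_int_def power_diff_sumr2[of z "nat k" y])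
next
  case False
  define N where "N = nat (- k)"
  have k: "k = - int N" using False by (simp add: N_def)
  have "(z - y) * powi_quotient k z y =
      - ((z - y) * (\<Sum>i<N. y ^ (N - Suc i) * z ^ i)) * (z * y) powi k"
    using False by (simp add: powi_quotient_def N_def)
  also have "\<dots> = - (z ^ N - y ^ N) * (z * y) powi k"
    by (simp only: power_diff_sumr2)
  also have "\<dots> = z powi k - y powi k"
    using assms by (simp add: k power_int_minus power_mult_distrib field_simps)
  finally show ?thesis by simp
qed

lemma powi_quotient_diag:
  assumes "z \<noteq> 0"
  shows "z * powi_quotient k z z = of_int k * z powi k"
proof (cases "k \<ge> 0")
  case True
  have "z * (\<Sum>i<nat k. z ^ (nat k - Suc i) * z ^ i) = (\<Sum>i<nat k. z ^ nat k)"
    unfolding sum_distrib_left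
    by (intro sum.cong refl) (simp flip: power_add power_Suc add: mult_ac)
  then show ?thesis
    using True by (simp add: powi_quotient_def power_int_def)
next
  case False
  define N where "N = nat (- k)"
  have k: "k = - int N" using False by (simp add: N_def)
  have "z * (\<Sum>i<N. z ^ (N - Suc i) * z ^ i) = (\<Sum>i<N. z ^ N)"
    unfolding sum_distrib_left
    by (intro sum.cong refl) (simp flip: power_add power_Suc add: mult_ac)
  then have *: "z * (\<Sum>i<N. z ^ (N - Suc i) * z ^ i) = of_nat N * z ^ N" by simp
  have "z * powi_quotient k z z = - (z * (\<Sum>i<N. z ^ (N - Suc i) * z ^ i)) * (z * z) powi k"
    using False by (simp add: powi_quotient_def N_def)
  also have "\<dots> = of_int k * z powi k"
    unfolding * using assms by (simp add: k power_int_minus power_mult_distrib field_simps)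
  finally show ?thesis .
qed

lemma laurent_sum_diff_eq:
  assumes "z \<noteq> 0" "y \<noteq> 0"
  shows "laurent_sum m n a z - laurent_sum m n a y = (z - y) * laurent_quotient m n a z y"
  unfolding laurent_sum_def laurent_quotient_def sum_subtractf[symmetric] sum_distrib_left
    right_diff_distrib[symmetric] powi_diff_eq[OF assms]
  by (simp add: mult_ac)

text \<open>On the diagonal the quotient is the complex derivative; the factor
  \<open>\<i> * z\<close> comes from differentiating \<open>cis\<close>.\<close>

lemma laurent_quotient_diag:
  assumes "z \<noteq> 0"
  shows "\<i> * z * laurent_quotient m n a z z = laurent_tangent m n a z"
proof -
  have "\<i> * z * laurent_quotient m n a z z = (\<Sum>k=m..n. a k * (\<i> * (z * powi_quotient k z z)))"
    unfolding laurent_quotient_def sum_distrib_left by (intro sum.cong) (auto simp: mult_ac)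
  also have "\<dots> = laurent_tangent m n a z"
    unfolding laurent_tangent_def powi_quotient_diag[OF assms] by (simp add: mult_ac)
  finally show ?thesis .
qed

lemma laurent_quotient_eq_0_iff:
  assumes "z \<in> sphere 0 1" "y \<in> sphere 0 1"
  shows "laurent_quotient m n a z y = 0 \<longleftrightarrow>
    (if z = y then laurent_tangent m n a z = 0 else laurent_sum m n a z = laurent_sum m n a y)"
proof -
  have nz: "z \<noteq> 0" "y \<noteq> 0" using assms by auto
  show ?thesis
    using laurent_quotient_diag[OF nz(1), of m n a] laurent_sum_diff_eq[OF nz, of m n a] nz
    by (auto simp: eq_iff_diff_eq_0[of "laurent_sum m n a z"])
qed

text \<open>The right side has no inequalities between the points, so it describes a closed
  condition on a compact torus. Coinciding points do no harm: a zero of the quotient on the diagonal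
  already means a vanishing tangent.\<close>

lemma not_generic_coeffs_iff:
  "\<not> generic_coeffs m n a \<longleftrightarrow>
     (\<exists>z\<in>sphere 0 1. \<exists>y\<in>sphere 0 1. \<exists>x\<in>sphere 0 1. laurent_quotient m n a z y = 0 \<and>
        (Im (cnj (laurent_tangent m n a z) * laurent_tangent m n a y) = 0 \<or>
         laurent_quotient m n a z x = 0 \<and> laurent_quotient m n a y x = 0))"
    (is "_ \<longleftrightarrow> ?R")
proof
  assume "\<not> generic_coeffs m n a"
  then consider z where "z \<in> sphere 0 1" "laurent_tangent m n a z = 0"
    | z y where "z \<in> sphere 0 1" "y \<in> sphere 0 1" "z \<noteq> y" "laurent_sum m n a z = laurent_sum m n a y"
       "Im (cnj (laurent_tangent m n a z) * laurent_tangent m n a y) = 0"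
    | z y x where "z \<in> sphere 0 1" "y \<in> sphere 0 1" "x \<in> sphere 0 1" "z \<noteq> y" "z \<noteq> x" "y \<noteq> x"
       "laurent_sum m n a z = laurent_sum m n a y" "laurent_sum m n a z = laurent_sum m n a x"
    unfolding generic_coeffs_def by blast
  then show ?R
  proof cases
    case 1
    then have "laurent_quotient m n a z z = 0 \<and>
        Im (cnj (laurent_tangent m n a z) * laurent_tangent m n a z) = 0"
      by (simp add: laurent_quotient_eq_0_iff)
    with 1 show ?thesis by blast
  next
    case 2
    then have "laurent_quotient m n a z y = 0"
      by (simp add: laurent_quotient_eq_0_iff)
    with 2 show ?thesis by blast
  next
    case 3
    then have "laurent_quotient m n a z y = 0 \<and> laurent_quotient m n a z x = 0 \<and>
        laurent_quotient m n a y x = 0"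
      by (simp add: laurent_quotient_eq_0_iff)
    with 3 show ?thesis by blast
  qed
next
  assume ?R
  then obtain z y x where *: "z \<in> sphere 0 1" "y \<in> sphere 0 1" "x \<in> sphere 0 1"
    "laurent_quotient m n a z y = 0"
    "Im (cnj (laurent_tangent m n a z) * laurent_tangent m n a y) = 0 \<or>
     laurent_quotient m n a z x = 0 \<and> laurent_quotient m n a y x = 0"
    by blast
  show "\<not> generic_coeffs m n a"
  proof
    assume g: "generic_coeffs m n a"
    have distinct: "p \<noteq> q \<and> laurent_sum m n a p = laurent_sum m n a q"
      if "p \<in> sphere 0 1" "q \<in> sphere 0 1" "laurent_quotient m n a p q = 0" for p q
      using that g laurent_quotient_eq_0_iff[of p q m n a] unfolding generic_coeffs_def
      by (auto split: if_splits)
    show False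
      using * g distinct unfolding generic_coeffs_def by metis
  qed
qed

lemma continuous_on_powi_quotient:
  "continuous_on (sphere 0 1 \<times> sphere 0 1) (\<lambda>p. powi_quotient k (fst p) (snd p))"
  unfolding powi_quotient_def by (cases "k \<ge> 0") (auto intro!: continuous_intros)

text \<open>By \<open>not_generic_coeffs_iff\<close> the set is the projection of a closed subset of
  \<open>X\<close>, and projecting along the compact factor \<open>K\<close> is a closed
  map.\<close>

lemma closedin_not_generic_coeffs:
  fixes m n :: int
  defines "P \<equiv> product_topology (\<lambda>_. euclidean :: complex topology) {m..n}"
  shows "closedin P {a \<in> topspace P. \<not> generic_coeffs m n a}"
proof -
  define K where "K = (sphere 0 1 \<times> sphere 0 1 \<times> sphere 0 1 :: (complex \<times> complex \<times> complex) set)"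
  define X where "X = prod_topology P (top_of_set K)"
  have cmap_mult: "continuous_map T euclidean (\<lambda>x. f x * g x :: complex)"
    if "continuous_map T euclidean f" "continuous_map T euclidean g"
    for T :: "((int \<Rightarrow> complex) \<times> (complex \<times> complex \<times> complex)) topology" and f g
    using that by (simp add: continuous_map_atin tendsto_mult)
  have coeff: "continuous_map X euclidean (\<lambda>p. fst p k)" if "k \<in> {m..n}" for k
    using continuous_map_compose[OF continuous_map_fst continuous_map_product_coordinates[OF that]]
    by (simp add: X_def P_def o_def)
  have param: "continuous_map X euclidean (\<lambda>p. h (snd p))" if "continuous_on K h"
    for h :: "complex \<times> complex \<times> complex \<Rightarrow> complex"
  proof -
    have "continuous_map (top_of_set K) euclidean h" using that by simp
    from continuous_map_compose[OF continuous_map_snd this] show ?thesis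
      by (simp add: X_def o_def)
  qed
  have tangent: "continuous_map X euclidean (\<lambda>p. laurent_tangent m n (fst p) (h (snd p)))"
    if "continuous_on K h" "h ` K \<subseteq> sphere 0 1" for h :: "complex \<times> complex \<times> complex \<Rightarrow> complex"
    unfolding laurent_tangent_def
    by (intro continuous_map_sum cmap_mult coeff param) (use that in \<open>auto intro!: continuous_intros\<close>)
  have quot: "continuous_map X euclidean (\<lambda>p. laurent_quotient m n (fst p) (h (snd p)) (h' (snd p)))"
    if "continuous_on K h" "h ` K \<subseteq> sphere 0 1" "continuous_on K h'" "h' ` K \<subseteq> sphere 0 1"
    for h h' :: "complex \<times> complex \<times> complex \<Rightarrow> complex"
  proof -
    have "continuous_on K (\<lambda>q. powi_quotient k (h q) (h' q))" for k
      using continuous_on_compose2[OF continuous_on_powi_quotient, of K "\<lambda>q. (h q, h' q)" k] that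
      by (auto intro!: continuous_intros)
    then show ?thesis
      unfolding laurent_quotient_def
      by (intro continuous_map_sum cmap_mult coeff param) auto
  qed
  let ?z = "\<lambda>p. fst (snd p)" and ?y = "\<lambda>p. fst (snd (snd p))" and ?x = "\<lambda>p. snd (snd (snd p))"
  let ?Q1 = "\<lambda>p. laurent_quotient m n (fst p) (?z p) (?y p)"
  let ?Q2 = "\<lambda>p. laurent_quotient m n (fst p) (?z p) (?x p)"
  let ?Q3 = "\<lambda>p. laurent_quotient m n (fst p) (?y p) (?x p)"
  let ?J = "\<lambda>p. cnj (laurent_tangent m n (fst p) (?z p)) * laurent_tangent m n (fst p) (?y p)"
  have zero: "closedin X {p \<in> topspace X. f p \<in> C}" if "continuous_map X euclidean f" "closed C"
    for f :: "_ \<Rightarrow> complex" and C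
    using closedin_continuous_map_preimage[OF that(1)] that(2) by simp
  have K: "continuous_on K fst" "continuous_on K (\<lambda>q. fst (snd q))" "continuous_on K (\<lambda>q. snd (snd q))"
    "fst ` K \<subseteq> sphere 0 1" "(\<lambda>q. fst (snd q)) ` K \<subseteq> sphere 0 1" "(\<lambda>q. snd (snd q)) ` K \<subseteq> sphere 0 1"
    by (auto simp: K_def intro!: continuous_intros)
  have Q: "continuous_map X euclidean ?Q1" "continuous_map X euclidean ?Q2" "continuous_map X euclidean ?Q3"
    by (intro quot K)+
  have cnj: "continuous_map X euclidean (\<lambda>p. cnj (laurent_tangent m n (fst p) (?z p)))"
  proof -
    have "continuous_map euclidean euclidean cnj" by (simp add: continuous_on_cnj)
    from continuous_map_compose[OF tangent[OF K(1,4)] this] show ?thesis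
      by (simp add: o_def)
  qed
  have J: "continuous_map X euclidean ?J"
    by (intro cmap_mult cnj tangent K)
  have "closed {w. Im w = 0}"
    by (intro closed_Collect_eq continuous_intros)
  then have "closedin X ({p \<in> topspace X. ?Q1 p \<in> {0}} \<inter> ({p \<in> topspace X. ?J p \<in> {w. Im w = 0}} \<union>
      ({p \<in> topspace X. ?Q2 p \<in> {0}} \<inter> {p \<in> topspace X. ?Q3 p \<in> {0}})))" (is "closedin X ?C")
    by (intro closedin_Int closedin_Un zero Q J) auto
  moreover have "closed_map X P fst"
    unfolding X_def by (intro closed_map_fst)
      (auto simp: K_def compact_space_subtopology compactin_euclidean_iff compact_Times)
  ultimately have "closedin P (fst ` ?C)"
    by (simp add: closed_map_def)
  also have "fst ` ?C = {a \<in> topspace P. \<not> generic_coeffs m n a}"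
  proof (intro set_eqI iffI)
    fix a assume "a \<in> {a \<in> topspace P. \<not> generic_coeffs m n a}"
    then obtain z y x where "a \<in> topspace P" "z \<in> sphere 0 1" "y \<in> sphere 0 1" "x \<in> sphere 0 1"
      "laurent_quotient m n a z y = 0 \<and>
        (Im (cnj (laurent_tangent m n a z) * laurent_tangent m n a y) = 0 \<or>
         laurent_quotient m n a z x = 0 \<and> laurent_quotient m n a y x = 0)"
      unfolding not_generic_coeffs_iff by blast
    then show "a \<in> fst ` ?C"
      by (intro image_eqI[of _ _ "(a, z, y, x)"]) (auto simp: X_def K_def)
  next
    fix a assume "a \<in> fst ` ?C"
    then obtain p where p: "p \<in> ?C" "a = fst p" by blast
    obtain z y x where "p = (a, z, y, x)" using p(2) by (cases p) auto
    with p(1) have *: "(a, z, y, x) \<in> ?C" by (simp only:)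
    have "a \<in> topspace P" "z \<in> sphere 0 1" "y \<in> sphere 0 1" "x \<in> sphere 0 1"
      using * unfolding X_def K_def by auto
    moreover have "laurent_quotient m n a z y = 0 \<and>
        (Im (cnj (laurent_tangent m n a z) * laurent_tangent m n a y) = 0 \<or>
         laurent_quotient m n a z x = 0 \<and> laurent_quotient m n a y x = 0)"
      using * by auto
    ultimately show "a \<in> {a \<in> topspace P. \<not> generic_coeffs m n a}"
      unfolding not_generic_coeffs_iff by blast
  qed
  finally show ?thesis .
qed

lemma generic_coeffs_cong:
  assumes "\<And>k. k \<in> {m..n} \<Longrightarrow> a k = b k"
  shows "generic_coeffs m n a \<longleftrightarrow> generic_coeffs m n b"
proof -
  have "laurent_sum m n a = laurent_sum m n b" "laurent_tangent m n a = laurent_tangent m n b"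
    unfolding laurent_sum_def laurent_tangent_def using assms by (auto intro!: ext sum.cong)
  then show ?thesis by (simp add: generic_coeffs_def)
qed

section \<open>Generic coefficients and normal curves\<close>

text \<open>An injective linear map satisfies \<open>norm (F' h) \<ge> B * norm h\<close> with
  \<open>B > 0\<close>. Near \<open>x\<close> the remainder is at most half of this bound and cannot
  cancel the linear part.\<close>

lemma eventually_neq_if_inj_derivative:
  fixes F :: "'a::euclidean_space \<Rightarrow> 'b::euclidean_space"
  assumes "(F has_derivative F') (at x)" "inj F'"
  shows "eventually (\<lambda>y. F y \<noteq> F x) (at x)"
proof -
  have "linear F'" using assms(1) by (rule has_derivative_linear)
  then obtain B where B: "B > 0" "\<And>h. norm (F' h) \<ge> B * norm h"
    using linear_inj_bounded_below_pos[of F'] assms(2) by blast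
  obtain d where d: "d > 0"
    "\<And>y. norm (y - x) < d \<Longrightarrow> norm (F y - F x - F' (y - x)) \<le> B / 2 * norm (y - x)"
    using assms(1) B(1) unfolding has_derivative_at_alt by (meson half_gt_zero)
  have "F y \<noteq> F x" if "y \<noteq> x" "dist y x < d" for y
  proof
    assume "F y = F x"
    then have "norm (F' (y - x)) \<le> B / 2 * norm (y - x)"
      using d(2)[of y] that(2) by (simp add: dist_norm)
    with B(2)[of "y - x"] have "B * norm (y - x) \<le> B / 2 * norm (y - x)" by linarith
    then show False using B(1) that(1) by simp
  qed
  then show ?thesis using d(1) unfolding eventually_at by blast
qed

lemma independent_pair_complex_iff:
  fixes A B :: complex
  assumes "A \<noteq> B"
  shows "independent {A, B} \<longleftrightarrow> Im (cnj A * B) \<noteq> 0"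
proof
  assume ind: "independent {A, B}"
  show "Im (cnj A * B) \<noteq> 0"
  proof
    assume "Im (cnj A * B) = 0"
    then obtain a b :: real where ab: "a \<noteq> 0 \<or> b \<noteq> 0" "of_real a * A = of_real b * B"
      by (rule collinear_coefficients)
    have "B \<noteq> 0" using ind dependent_zero[of "{A, B}"] by auto
    then have "a \<noteq> 0" using ab by auto
    then have "A = (b / a) *\<^sub>R B"
      using ab(2) by (simp add: scaleR_conv_of_real field_simps)
    then have "A \<in> span {B}" by (auto simp: span_singleton)
    then show False using ind assms by (simp add: independent_insert)
  qed
next
  assume im: "Im (cnj A * B) \<noteq> 0"
  then have "B \<noteq> 0" by auto
  moreover have "A \<notin> span {B}"
  proof
    assume "A \<in> span {B}"
    then obtain r where "A = r *\<^sub>R B" by (auto simp: span_singleton)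
    then show False using im by (simp add: scaleR_conv_of_real)
  qed
  ultimately show "independent {A, B}"
    by (simp add: independent_insert assms)
qed

lemma bij_betw_cis: "bij_betw cis {0..<2*pi} (sphere 0 1)"
proof (rule bij_betw_imageI)
  show "inj_on cis {0..<2*pi}"
  proof (rule inj_on_inverseI)
    fix s :: real assume "s \<in> {0..<2*pi}"
    then show "Arg2pi (cis s) = s"
      by (intro Arg2pi_unique[of 1]) (auto simp: cis_conv_exp)
  qed
  have "z \<in> cis ` {0..<2*pi}" if "z \<in> sphere 0 1" for z
    using that Arg2pi_eq[of z] Arg2pi_ge_0[of z] Arg2pi_lt_2pi[of z]
    by (intro image_eqI[of _ _ "Arg2pi z"]) (auto simp: cis_conv_exp)
  then show "cis ` {0..<2*pi} = sphere 0 1" by auto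
qed

text \<open>Infinitely many double points would accumulate in the compact square. The limit is again
  a double point, with independent tangents, and there the difference of the two curve values has an
  injective derivative, so its zeros are isolated.\<close>

lemma finite_double_points:
  assumes "generic_coeffs m n a"
  shows "finite {(s, t). s \<in> {0..<2*pi} \<and> t \<in> {0..<2*pi} \<and> s \<noteq> t \<and>
           laurent_sum m n a (cis s) = laurent_sum m n a (cis t)}" (is "finite ?Z")
proof (rule ccontr)
  \<comment> \<open>The closed square is taken for compactness. It contains pairs such as
    \<open>(0, 2*pi)\<close> that give the same point of the circle, so the quotient replaces the
    plain difference of values.\<close>
  define Z where "Z = {p \<in> cbox (0, 0) (2*pi, 2*pi). laurent_quotient m n a (cis (fst p)) (cis (snd p)) = 0}"
  assume inf: "infinite ?Z"
  have Z: "?Z \<subseteq> Z"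
  proof clarify
    fix s t :: real
    assume st: "s \<in> {0..<2*pi}" "t \<in> {0..<2*pi}" "s \<noteq> t"
      "laurent_sum m n a (cis s) = laurent_sum m n a (cis t)"
    then have "cis s \<noteq> cis t"
      using bij_betw_cis by (auto simp: bij_betw_def dest: inj_onD)
    then show "(s, t) \<in> Z"
      using st by (auto simp: Z_def cbox_Pair_eq laurent_quotient_eq_0_iff)
  qed
  have cont: "continuous_on UNIV (\<lambda>p. laurent_quotient m n a (cis (fst p)) (cis (snd p)))"
  proof -
    have "continuous_on UNIV (\<lambda>p::real\<times>real. (cis (fst p), cis (snd p)))"
      by (auto simp: cis_conv_exp intro!: continuous_intros)
    then have "continuous_on UNIV (\<lambda>p::real\<times>real. powi_quotient k (cis (fst p)) (cis (snd p)))" for k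
      using continuous_on_compose2[OF continuous_on_powi_quotient, of UNIV "\<lambda>p::real\<times>real. (cis (fst p), cis (snd p))" k]
      by (simp add: image_subset_iff)
    then show ?thesis
      unfolding laurent_quotient_def by (intro continuous_intros)
  qed
  have "compact Z"
  proof -
    have "closed {p. laurent_quotient m n a (cis (fst p)) (cis (snd p)) = 0}"
      using cont by (intro closed_Collect_eq continuous_on_const)
    then have "compact (cbox (0,0) (2*pi, 2*pi) \<inter> {p. laurent_quotient m n a (cis (fst p)) (cis (snd p)) = 0})"
      by (intro compact_Int_closed compact_cbox)
    then show ?thesis by (simp add: Z_def Collect_conj_eq)
  qed
  then obtain p where p: "p \<in> Z" "p islimpt ?Z"
    using inf Z unfolding compact_eq_Bolzano_Weierstrass by blast
  obtain s t where st: "p = (s, t)" by (cases p)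
  let ?D = "laurent_tangent m n a" and ?L = "laurent_sum m n a"
  have "laurent_quotient m n a (cis s) (cis t) = 0" using p(1) by (simp add: Z_def st)
  \<comment> \<open>Regularity keeps the limit off the diagonal of the torus.\<close>
  then have "cis s \<noteq> cis t" and eq: "?L (cis s) = ?L (cis t)"
    using assms unfolding generic_coeffs_def
    by (auto simp: laurent_quotient_eq_0_iff split: if_splits)
  then have im: "Im (cnj (?D (cis s)) * ?D (cis t)) \<noteq> 0"
    using assms unfolding generic_coeffs_def by auto
  define F where "F q = ?L (cis (fst q)) - ?L (cis (snd q))" for q
  define F' where "F' d = fst d *\<^sub>R ?D (cis s) - snd d *\<^sub>R ?D (cis t)" for d :: "real \<times> real"
  have der: "((\<lambda>s. ?L (cis s)) has_derivative (\<lambda>d. d *\<^sub>R ?D (cis s))) (at s)" for s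
    using has_vector_derivative_laurent_sum_cis by (simp add: has_vector_derivative_def)
  have "((\<lambda>q. ?L (cis (fst q))) has_derivative (\<lambda>d. fst d *\<^sub>R ?D (cis s))) (at p)"
    by (rule has_derivative_compose[of fst fst _ _ "\<lambda>s. ?L (cis s)" "\<lambda>d. d *\<^sub>R ?D (cis s)"])
      (auto simp: st intro: der bounded_linear_imp_has_derivative bounded_linear_fst)
  moreover have "((\<lambda>q. ?L (cis (snd q))) has_derivative (\<lambda>d. snd d *\<^sub>R ?D (cis t))) (at p)"
    by (rule has_derivative_compose[of snd snd _ _ "\<lambda>s. ?L (cis s)" "\<lambda>d. d *\<^sub>R ?D (cis t)"])
      (auto simp: st intro: der bounded_linear_imp_has_derivative bounded_linear_snd)
  ultimately have "(F has_derivative F') (at p)"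
    unfolding F_def[abs_def] F'_def[abs_def] by (rule has_derivative_diff)
  moreover have "inj F'"
  proof -
    have "linear F'" using \<open>(F has_derivative F') (at p)\<close> by (rule has_derivative_linear)
    moreover have "d = 0" if "F' d = 0" for d
    proof -
      obtain b c where d: "d = (b, c)" by (cases d)
      have e: "of_real b * ?D (cis s) = of_real c * ?D (cis t)"
        using that by (simp add: F'_def d scaleR_conv_of_real)
      have "c * Im (cnj (?D (cis s)) * ?D (cis t)) = Im (cnj (?D (cis s)) * (of_real c * ?D (cis t)))"
        by (simp add: algebra_simps)
      also have "\<dots> = 0"
        unfolding e[symmetric] by (simp add: algebra_simps)
      finally have "c * Im (cnj (?D (cis s)) * ?D (cis t)) = 0" .
      then have "c = 0" using im by simp
      moreover have "?D (cis s) \<noteq> 0" using im by auto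
      ultimately show ?thesis using e d by (simp add: zero_prod_def)
    qed
    ultimately show ?thesis by (simp add: linear_injective_0)
  qed
  ultimately have "eventually (\<lambda>q. F q \<noteq> F p) (at p)"
    by (rule eventually_neq_if_inj_derivative)
  moreover have "frequently (\<lambda>q. q \<in> ?Z) (at p)"
    using p(2) by (simp add: islimpt_conv_frequently_at)
  ultimately have "frequently (\<lambda>q. q \<in> ?Z \<and> F q \<noteq> F p) (at p)"
    by (rule frequently_eventually_frequently[rotated])
  then obtain q where "q \<in> ?Z" "F q \<noteq> F p" by (auto dest: frequently_ex)
  then show False using eq by (auto simp: F_def st)
qed

text \<open>The bijection \<open>cis\<close> from \<open>{0..<2*pi}\<close> to the circle matches
  parameters with points, and \<open>finite_double_points\<close> supplies the finiteness
  clause.\<close>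

lemma normal_curve_laurent_sum_iff:
  "normal_curve (\<lambda>t. laurent_sum m n a (cis t)) \<longleftrightarrow> generic_coeffs m n a"
proof
  let ?\<gamma> = "\<lambda>t. laurent_sum m n a (cis t)"
  have vd: "vector_derivative ?\<gamma> (at t) = laurent_tangent m n a (cis t)" for t
    by (rule vector_derivative_at[OF has_vector_derivative_laurent_sum_cis])
  have inj: "cis s = cis t \<longleftrightarrow> s = t" if "s \<in> {0..<2*pi}" "t \<in> {0..<2*pi}" for s t
    using bij_betw_cis that by (auto simp: bij_betw_def dest: inj_onD)
  have surj: "\<exists>t\<in>{0..<2*pi}. z = cis t" if "z \<in> sphere 0 1" for z
    using bij_betw_cis that by (auto simp: bij_betw_def)
  {
    assume N: "normal_curve ?\<gamma>"
    have cross: "simple_transversal_crossing ?\<gamma> s t"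
      if "s \<in> {0..<2*pi}" "t \<in> {0..<2*pi}" "s \<noteq> t" "?\<gamma> s = ?\<gamma> t" for s t
    proof -
      have "{s, t} \<in> self_intersections ?\<gamma>"
        unfolding self_intersections_def using that by blast
      then show ?thesis using N unfolding normal_curve_def by blast
    qed
    show "generic_coeffs m n a"
      unfolding generic_coeffs_def
    proof (intro conjI ballI impI)
      fix z :: complex assume "z \<in> sphere 0 1"
      then obtain t where "z = cis t" using surj by blast
      then show "laurent_tangent m n a z \<noteq> 0"
        using N by (simp add: normal_curve_def regular_curve_def vd)
    next
      fix z y :: complex
      assume zy: "z \<in> sphere 0 1" "y \<in> sphere 0 1"
        and eq: "z \<noteq> y \<and> laurent_sum m n a z = laurent_sum m n a y"
      obtain s t where st: "s \<in> {0..<2*pi}" "z = cis s" "t \<in> {0..<2*pi}" "y = cis t"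
        using surj zy by metis
      then have "simple_transversal_crossing ?\<gamma> s t" using eq by (intro cross) auto
      then show "Im (cnj (laurent_tangent m n a z) * laurent_tangent m n a y) \<noteq> 0"
        unfolding simple_transversal_crossing_def vd st(2,4)
        using independent_pair_complex_iff by blast
    next
      fix z y x :: complex
      assume zyx: "z \<in> sphere 0 1" "y \<in> sphere 0 1" "x \<in> sphere 0 1"
        and ne: "z \<noteq> y \<and> z \<noteq> x \<and> y \<noteq> x"
      obtain s t u where stu: "s \<in> {0..<2*pi}" "z = cis s" "t \<in> {0..<2*pi}" "y = cis t"
        "u \<in> {0..<2*pi}" "x = cis u"
        using surj zyx by metis
      show "\<not> (laurent_sum m n a z = laurent_sum m n a y \<and> laurent_sum m n a z = laurent_sum m n a x)"
      proof
        assume eq: "laurent_sum m n a z = laurent_sum m n a y \<and> laurent_sum m n a z = laurent_sum m n a x"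
        then have "simple_transversal_crossing ?\<gamma> s t" using stu ne by (intro cross) auto
        then have "{u \<in> {0..<2*pi}. ?\<gamma> u = ?\<gamma> s} = {s, t}"
          unfolding simple_transversal_crossing_def by blast
        moreover have "u \<in> {u \<in> {0..<2*pi}. ?\<gamma> u = ?\<gamma> s}"
          using eq stu(5) unfolding stu(2,4,6) mem_Collect_eq by metis
        ultimately have "u = s \<or> u = t" by blast
        then show False using ne stu by blast
      qed
    qed
  next
    assume G: "generic_coeffs m n a"
    show "normal_curve ?\<gamma>"
      unfolding normal_curve_def
    proof (intro conjI allI impI)
      have "continuous_on UNIV (\<lambda>t. laurent_tangent m n a (cis t))"
        unfolding laurent_tangent_eq_laurent_sum
        by (intro continuous_at_imp_continuous_on ballI has_vector_derivative_continuous[OF has_vector_derivative_laurent_sum_cis])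
      then have "?\<gamma> C1_differentiable_on UNIV"
        unfolding C1_differentiable_on_def
        by (intro exI[of _ "\<lambda>t. laurent_tangent m n a (cis t)"] conjI ballI
            has_vector_derivative_laurent_sum_cis)
      moreover have "cis (t + 2 * pi) = cis t" for t
        by (simp add: cis_mult[symmetric])
      ultimately show "regular_curve ?\<gamma>"
        using G by (simp add: regular_curve_def C1_closed_curve_def vd generic_coeffs_def)
      have "self_intersections ?\<gamma> \<subseteq> (\<lambda>(s, t). {s, t}) ` {(s, t). s \<in> {0..<2*pi} \<and> t \<in> {0..<2*pi} \<and> s \<noteq> t \<and> ?\<gamma> s = ?\<gamma> t}"
        unfolding self_intersections_def by auto
      then show "finite (self_intersections ?\<gamma>)"
        using finite_double_points[OF G] finite_surj by blast
    next
      fix s t assume "{s, t} \<in> self_intersections ?\<gamma>"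
      then have st: "s \<in> {0..<2*pi}" "t \<in> {0..<2*pi}" "s \<noteq> t" "?\<gamma> s = ?\<gamma> t"
        unfolding self_intersections_def by (auto simp: doubleton_eq_iff)
      have im: "Im (cnj (laurent_tangent m n a (cis s)) * laurent_tangent m n a (cis t)) \<noteq> 0"
        using G st inj[OF st(1,2)] unfolding generic_coeffs_def by simp
      \<comment> \<open>For equal tangents the product \<open>cnj A * A\<close> would be
        real.\<close>
      then have ne: "laurent_tangent m n a (cis s) \<noteq> laurent_tangent m n a (cis t)"
        by (auto simp: mult.commute)
      have "u = s \<or> u = t" if u: "u \<in> {0..<2*pi}" "?\<gamma> u = ?\<gamma> s" for u
      proof (rule ccontr)
        assume "\<not> (u = s \<or> u = t)"
        then have "cis u \<noteq> cis s" "cis u \<noteq> cis t" "cis s \<noteq> cis t"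
          using inj st u(1) by blast+
        moreover have "cis u \<in> sphere 0 1" "cis s \<in> sphere 0 1" "cis t \<in> sphere 0 1" by simp_all
        ultimately show False
          using G u(2) st(4) unfolding generic_coeffs_def by metis
      qed
      then have "{u \<in> {0..<2*pi}. ?\<gamma> u = ?\<gamma> s} = {s, t}" using st by auto
      then show "simple_transversal_crossing ?\<gamma> s t"
        unfolding simple_transversal_crossing_def vd using ne im independent_pair_complex_iff by blast
    qed
  }
qed

section \<open>Transfer to Laurent polynomials and their topology\<close>

lemma laurent_curve_eq_laurent_sum:
  assumes "Poly_Mapping.keys p \<subseteq> {m..n}"
  shows "laurent_curve p = (\<lambda>t. laurent_sum m n (Poly_Mapping.lookup p) (cis t))"
  unfolding laurent_curve_def laurent_eval_def laurent_sum_def cis_conv_exp[symmetric]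
  using assms by (intro ext sum.mono_neutral_left) (auto simp: in_keys_iff)

lemma normal_laurent_polys_eq:
  "normal_laurent_polys m n = {p \<in> laurent_polys m n. generic_coeffs m n (coeff_vector m n p)}"
proof -
  have "normal_curve (laurent_curve p) \<longleftrightarrow> generic_coeffs m n (coeff_vector m n p)"
    if "p \<in> laurent_polys m n" for p
  proof -
    have "Poly_Mapping.keys p \<subseteq> {m..n}" using that by (simp add: laurent_polys_def)
    then have "normal_curve (laurent_curve p) \<longleftrightarrow> generic_coeffs m n (Poly_Mapping.lookup p)"
      by (simp only: laurent_curve_eq_laurent_sum normal_curve_laurent_sum_iff)
    also have "\<dots> \<longleftrightarrow> generic_coeffs m n (coeff_vector m n p)"
      by (rule generic_coeffs_cong) (simp add: coeff_vector_def)
    finally show ?thesis .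
  qed
  then show ?thesis unfolding normal_laurent_polys_def by blast
qed

lemma openin_normal_laurent_polys: "openin (laurent_topology m n) (normal_laurent_polys m n)"
proof -
  let ?P = "product_topology (\<lambda>_. euclidean :: complex topology) {m..n}"
  have "openin ?P (topspace ?P - {a \<in> topspace ?P. \<not> generic_coeffs m n a})"
    using closedin_not_generic_coeffs by blast
  moreover have "normal_laurent_polys m n =
      coeff_vector m n -` (topspace ?P - {a \<in> topspace ?P. \<not> generic_coeffs m n a}) \<inter> laurent_polys m n"
    by (auto simp: normal_laurent_polys_eq coeff_vector_def)
  ultimately show ?thesis
    unfolding laurent_topology_def openin_pullback_topology by blast
qed

lemma laurent_polys_subset_closure_of_normal:
  assumes "m < n"
  shows "laurent_polys m n \<subseteq> laurent_topology m n closure_of normal_laurent_polys m n"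
proof
  fix p assume p: "p \<in> laurent_polys m n"
  let ?P = "product_topology (\<lambda>_. euclidean :: complex topology) {m..n}"
  let ?a = "Poly_Mapping.lookup p"
  have "\<exists>q\<in>normal_laurent_polys m n. q \<in> T" if T: "p \<in> T" "openin (laurent_topology m n) T" for T
  proof -
    obtain U where U: "openin ?P U" "T = coeff_vector m n -` U \<inter> laurent_polys m n"
      using T(2) unfolding laurent_topology_def openin_pullback_topology by blast
    obtain X where X: "coeff_vector m n p \<in> (\<Pi>\<^sub>E i\<in>{m..n}. X i)" "\<And>i. open (X i)"
      "(\<Pi>\<^sub>E i\<in>{m..n}. X i) \<subseteq> U"
      using product_topology_open_contains_basis[OF U(1), of "coeff_vector m n p"] T(1) U(2)
      by auto
    have "\<forall>i\<in>{m..n}. \<exists>d>0. ball (?a i) d \<subseteq> X i"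
      using X(1,2) by (auto simp: coeff_vector_def PiE_iff open_contains_ball)
    then obtain d where d: "\<And>i. i \<in> {m..n} \<Longrightarrow> d i > 0" "\<And>i. i \<in> {m..n} \<Longrightarrow> ball (?a i) (d i) \<subseteq> X i"
      by metis
    have am: "?a m \<noteq> 0" and an: "?a n \<noteq> 0" and keys: "Poly_Mapping.keys p \<subseteq> {m..n}"
      using p by (auto simp: laurent_polys_def)
    \<comment> \<open>Staying below \<open>d i\<close> keeps the coefficients inside the box;
      staying below the moduli of the end coefficients keeps those nonzero.\<close>
    define e where "e = Min ({cmod (?a m), cmod (?a n)} \<union> d ` {m..n})"
    have e: "e > 0" using am an d(1) by (simp add: e_def)
    have e_le: "e \<le> cmod (?a m)" "e \<le> cmod (?a n)" "\<And>i. i \<in> {m..n} \<Longrightarrow> e \<le> d i"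
      unfolding e_def by (rule Min_le; auto)+
    obtain b where b: "generic_coeffs m n b" "\<And>i. cmod (b i - ?a i) < e"
      using generic_coeffs_dense[of m n ?a e] assms am an e by blast
    \<comment> \<open>Cutting off outside \<open>{m..n}\<close> gives the finite support that a
      Laurent polynomial must have.\<close>
    define c where "c i = (if i \<in> {m..n} then b i else 0)" for i
    define q where "q = Poly_Mapping.Abs_poly_mapping c"
    have "finite {i. c i \<noteq> 0}"
      by (rule finite_subset[of _ "{m..n}"]) (auto simp: c_def)
    then have q: "Poly_Mapping.lookup q = c"
      unfolding q_def by (rule lookup_Abs_poly_mapping)
    have "c m \<noteq> 0" "c n \<noteq> 0"
      using b(2)[of m] b(2)[of n] e_le(1,2) assms by (auto simp: c_def)
    then have LP: "q \<in> laurent_polys m n"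
      by (auto simp: laurent_polys_def in_keys_iff q) (auto simp: c_def split: if_splits)
    have cv: "coeff_vector m n q = restrict b {m..n}"
      by (auto simp: coeff_vector_def q c_def)
    have "generic_coeffs m n (coeff_vector m n q)"
      using b(1) generic_coeffs_cong[of m n "coeff_vector m n q" b] by (simp add: cv)
    then have "q \<in> normal_laurent_polys m n" using LP by (simp add: normal_laurent_polys_eq)
    moreover have "b i \<in> X i" if "i \<in> {m..n}" for i
      using b(2)[of i] d(2)[OF that] e_le(3)[OF that]
      by (auto simp: subset_iff dist_norm norm_minus_commute)
    then have "coeff_vector m n q \<in> U" using X(3) by (auto simp: cv)
    ultimately show ?thesis using U(2) LP by blast
  qed
  then show "p \<in> laurent_topology m n closure_of normal_laurent_polys m n"
    using p by (auto simp: in_closure_of)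
qed

theorem theorem5p5:
  fixes m n :: int
  assumes "m < n"
  shows "openin (laurent_topology m n) (normal_laurent_polys m n) \<and>
         laurent_topology m n closure_of normal_laurent_polys m n = laurent_polys m n"
  using openin_normal_laurent_polys laurent_polys_subset_closure_of_normal[OF assms]
    closure_of_subset_topspace[of "laurent_topology m n" "normal_laurent_polys m n"]
  by auto

end
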